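(* Let $(Q,+)$ be a group, $\varphi,\psi\in Aut(Q,+)$, and $\beta,\gamma\in S_Q$. The left linear quasigroup $(Q,\cdot)$ given by $x\cdot y=\varphi x+\beta y$ and the quasigroup $(Q,\circ)$ given by $x\circ y=\gamma y+\psi x$ are orthogonal if and only if for every $t\in Q$ the map $(J_t\psi^{-1}\gamma-\varphi^{-1}\beta)$, i.e. $y\mapsto J_t\psi^{-1}\gamma y-\varphi^{-1}\beta y$, is a permutation of the set $Q$.
   Context: Groups are written additively but need not be commutative. $S_Q$ is the set of all permutations (bijections) of the set $Q$. Products of maps are compositions, $(\alpha\beta)x=\alpha(\beta x)$. For $t\in Q$, $J_t$ is the inner automorphism $J_tx=t+x-t$. Two quasigroups $(Q,\cdot)$ and $(Q,\circ)$ on the same set are orthogonal if for all $a,b\in Q$ the system $x\cdot y=a$, $x\circ y=b$ has a unique solution $(x,y)\in Q\times Q$. *)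

theory Defs
  imports Main
begin

text \<open>
  The class \<^class>\<open>group_add\<close> does not assume commutativity. The group \<open>(Q, +)\<close> is such a
  type, \<open>Q\<close> being the set of all its elements, so that the permutations of \<open>Q\<close> are the
  maps satisfying \<^const>\<open>bij\<close>.
\<close>

definition group_Aut :: "('a::group_add \<Rightarrow> 'a) set" where
  "group_Aut = {f. bij f \<and> (\<forall>x y. f (x + y) = f x + f y)}"

definition inner_aut :: "'a::group_add \<Rightarrow> 'a \<Rightarrow> 'a" where
  "inner_aut t x = t + x - t"

definition quasigroup :: "('a \<Rightarrow> 'a \<Rightarrow> 'a) \<Rightarrow> bool" where
  "quasigroup f \<longleftrightarrow> (\<forall>a b. (\<exists>!x. f a x = b) \<and> (\<exists>!y. f y a = b))"

definition orthogonal_quasigroups :: "('a \<Rightarrow> 'a \<Rightarrow> 'a) \<Rightarrow> ('a \<Rightarrow> 'a \<Rightarrow> 'a) \<Rightarrow> bool" where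
  "orthogonal_quasigroups f g \<longleftrightarrow>
     quasigroup f \<and> quasigroup g \<and>
     (\<forall>a b. \<exists>!p. f (fst p) (snd p) = a \<and> g (fst p) (snd p) = b)"

end

theory Submission
  imports Defs
begin

text \<open>
  Put \<open>B = \<phi>\<inverse>\<beta>\<close> and \<open>G = \<psi>\<inverse>\<gamma>\<close>. Applying \<open>\<phi>\<inverse>\<close> and \<open>\<psi>\<inverse>\<close> turns the
  system \<open>x \<cdot> y = a\<close>, \<open>x \<circ> y = b\<close> into \<open>x + B y = a'\<close>, \<open>G y + x = b'\<close>. Eliminating \<open>x\<close>
  leaves \<open>G y + a' - B y = b'\<close>, and with \<open>t = - a'\<close> this is
  \<open>J\<^sub>t (G y) - B y = t + b'\<close>.
\<close>

text \<open>Both sides of the equation are carried over by the additive bijection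
  \<open>inv f\<close>. Two forms are required because \<open>+\<close> need not commute:
  \<open>\<phi> x\<close> is a left summand, \<open>\<psi> x\<close> a right one.\<close>

lemma group_Aut_inv_eq_iff:
  assumes "f \<in> group_Aut"
  shows "f x + u = c \<longleftrightarrow> x + inv f u = inv f c"
    and "u + f x = c \<longleftrightarrow> inv f u + x = inv f c"
proof -
  have bij: "bij f" and add: "\<And>x y. f (x + y) = f x + f y"
    using assms by (auto simp: group_Aut_def)
  have f_inv: "f (inv f z) = z" for z
    using bij by (simp add: bij_is_surj surj_f_inv_f)
  have "z = inv f c \<longleftrightarrow> f z = c" for z
    using bij by (metis bij_inv_eq_iff)
  then show "f x + u = c \<longleftrightarrow> x + inv f u = inv f c"
    and "u + f x = c \<longleftrightarrow> inv f u + x = inv f c"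
    by (simp_all add: add f_inv)
qed

text \<open>Cancelling the known summand on its side leaves a bijection equal to a constant.\<close>

lemma quasigroup_bij_add:
  fixes \<alpha> \<beta> :: "'a::group_add \<Rightarrow> 'a"
  assumes "bij \<alpha>" and "bij \<beta>"
  shows "quasigroup (\<lambda>x y. \<alpha> x + \<beta> y)" and "quasigroup (\<lambda>x y. \<beta> y + \<alpha> x)"
proof -
  have left: "u + v = w \<longleftrightarrow> v = - u + w" for u v w :: 'a
    by (metis add.assoc add_0_left left_minus right_minus)
  have right: "u + v = w \<longleftrightarrow> u = w - v" for u v w :: 'a
    by (auto simp: algebra_simps)
  have ex1: "\<exists>!x. \<alpha> x = c" "\<exists>!x. \<beta> x = c" for c
    using assms by (simp_all add: bij_iff)
  have "\<exists>!x. c + \<alpha> x = b" "\<exists>!x. \<alpha> x + c = b" "\<exists>!x. c + \<beta> x = b" "\<exists>!x. \<beta> x + c = b" for b c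
    unfolding left[of c] right[of _ c] by (rule ex1)+
  then show "quasigroup (\<lambda>x y. \<alpha> x + \<beta> y)" and "quasigroup (\<lambda>x y. \<beta> y + \<alpha> x)"
    by (simp_all add: quasigroup_def)
qed

lemma ex1_pair_system_iff:
  fixes B G :: "'b \<Rightarrow> 'a::group_add"
  shows "(\<exists>!p. fst p + B (snd p) = a \<and> G (snd p) + fst p = b) \<longleftrightarrow>
    (\<exists>!y. inner_aut (- a) (G y) - B y = - a + b)"
proof -
  have x: "x + B y = a \<longleftrightarrow> x = a - B y" for x y
    by (auto simp: algebra_simps)
  have y: "inner_aut (- a) (G y) - B y = - a + b \<longleftrightarrow> G y + (a - B y) = b" for y
  proof -
    \<comment> \<open>Conjugation by \<open>- a\<close> ends in \<open>+ a\<close>, which joins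
      \<open>- B y\<close> to form the eliminated \<open>x\<close>; the leading \<open>- a\<close>
      then cancels.\<close>
    have "inner_aut (- a) (G y) - B y = - a + (G y + (a - B y))"
      by (simp add: inner_aut_def add.assoc diff_conv_add_uminus del: add_uminus_conv_diff)
    then show ?thesis
      by simp
  qed
  \<comment> \<open>Solutions are exactly the pairs \<open>(a - B y, y)\<close> with
    \<open>y\<close> solving the single equation, so uniqueness transfers both ways.\<close>
  show ?thesis
    unfolding x y by (auto simp: Ex1_def)
qed

theorem theorem43:
  fixes \<phi> \<psi> \<beta> \<gamma> :: "'a::group_add \<Rightarrow> 'a"
  assumes "\<phi> \<in> group_Aut" and "\<psi> \<in> group_Aut"
    and "bij \<beta>" and "bij \<gamma>"
  shows "orthogonal_quasigroups (\<lambda>x y. \<phi> x + \<beta> y) (\<lambda>x y. \<gamma> y + \<psi> x) \<longleftrightarrow>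
    (\<forall>t. bij (\<lambda>y. inner_aut t (inv \<psi> (\<gamma> y)) - inv \<phi> (\<beta> y)))"
proof -
  have bij: "bij \<phi>" "bij \<psi>"
    using assms by (auto simp: group_Aut_def)
  define D where "D t y = inner_aut t (inv \<psi> (\<gamma> y)) - inv \<phi> (\<beta> y)" for t y
  have "orthogonal_quasigroups (\<lambda>x y. \<phi> x + \<beta> y) (\<lambda>x y. \<gamma> y + \<psi> x) \<longleftrightarrow>
      (\<forall>a b. \<exists>!y. D (- inv \<phi> a) y = - inv \<phi> a + inv \<psi> b)"
    using quasigroup_bij_add(1)[OF bij(1) assms(3)] quasigroup_bij_add(2)[OF bij(2) assms(4)]
    unfolding orthogonal_quasigroups_def group_Aut_inv_eq_iff(1)[OF assms(1)]
      group_Aut_inv_eq_iff(2)[OF assms(2)] D_def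
    by (simp add: ex1_pair_system_iff[where B = "\<lambda>y. inv \<phi> (\<beta> y)" and G = "\<lambda>y. inv \<psi> (\<gamma> y)"])
  also have "\<dots> \<longleftrightarrow> (\<forall>t c. \<exists>!y. D t y = c)"
  proof (intro iffI allI)
    fix t c
    assume "\<forall>a b. \<exists>!y. D (- inv \<phi> a) y = - inv \<phi> a + inv \<psi> b"
    \<comment> \<open>The choice \<open>a = \<phi> (- t)\<close> makes the index \<open>t\<close>,
      and \<open>b = \<psi> (- t + c)\<close> makes the right-hand side
      \<open>t + (- t + c) = c\<close>.\<close>
    then have "\<exists>!y. D (- inv \<phi> (\<phi> (- t))) y = - inv \<phi> (\<phi> (- t)) + inv \<psi> (\<psi> (- t + c))"
      by blast
    then show "\<exists>!y. D t y = c"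
      using bij by (simp add: bij_is_inj flip: add.assoc)
  qed blast
  also have "\<dots> \<longleftrightarrow> (\<forall>t. bij (D t))"
    by (simp add: bij_iff)
  finally show ?thesis
    by (simp add: D_def[abs_def])
qed

end
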